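(* Let $k>4$ be an integer. For every integer $v>1$ for which a $(K_v,P_k)$-design exists, \[\left\{n\geq v-\left\lfloor\frac{k-6}{3}\right\rfloor\ \Big|\ n\equiv 0,1\pmod 4\right\}\subseteq\mathcal{L}_2P_k(v)\subseteq\mathcal{L}_1P_k(v).\]
   Context: All graphs are finite and simple; $\Gamma\leq K$ means $\Gamma$ is a subgraph of $K$ (or is isomorphic to one, when $\Gamma$ is an abstract graph). $P_k$ is the path on $k$ vertices. For a graph $K$ and $\Gamma\leq K$, a $(K,\Gamma)$-design is a set $\mathcal{B}$ of subgraphs of $K$, called blocks, each isomorphic to $\Gamma$, whose edge-sets partition $E(K)$. $K_n$ is the complete graph on a set of $n$ vertices (any $n$-element vertex set may be used); a $\Gamma$-design of order $n$ is a $(K_n,\Gamma)$-design. Given $\Gamma'\leq\Gamma$, a $(K,\Gamma)$-design $\mathcal{B}$ and a $(K',\Gamma')$-design $\mathcal{B}'$, a down-link from $\mathcal{B}$ to $\mathcal{B}'$ is a function $f:\mathcal{B}\to\mathcal{B}'$ such that $f(B)$ is a subgraph of $B$ for every $B\in\mathcal{B}$ (the vertex sets of $K$ and $K'$ need not coincide, and either may be the larger). Take $\Gamma'=P_3$. For $v$ such that a $(K_v,\Gamma)$-design exists: $\mathcal{L}_1\Gamma(v)$ is the set of all integers $n$ such that some $\Gamma$-design of order $v$ can be down-linked to a $P_3$-design of order $n$; $\mathcal{L}_2\Gamma(v)$ is the set of all integers $n$ such that every $\Gamma$-design of order $v$ can be down-linked to a $P_3$-design of order $n$. A $(K_v,P_k)$-design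 exists if and only if $v\geq k$ and $v(v-1)\equiv 0\pmod{2(k-1)}$. *)

theory Defs
  imports Complex_Main "HOL-Library.FuncSet" "HOL-Library.Disjoint_Sets"
    "HOL-Library.Infinite_Typeclass"
begin

text \<open>A graph is a pair of a vertex set and a set of edges, an edge being a two-element set of
  vertices.\<close>

type_synonym 'a sgraph = "'a set \<times> 'a set set"

abbreviation verts :: "'a sgraph \<Rightarrow> 'a set" where
  "verts G \<equiv> fst G"

abbreviation edges :: "'a sgraph \<Rightarrow> 'a set set" where
  "edges G \<equiv> snd G"

definition simple_graph :: "'a sgraph \<Rightarrow> bool" where
  "simple_graph G \<longleftrightarrow> finite (verts G) \<and> (\<forall>e\<in>edges G. e \<subseteq> verts G \<and> card e = 2)"

definition subgraph_of :: "'a sgraph \<Rightarrow> 'a sgraph \<Rightarrow> bool" where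
  "subgraph_of H G \<longleftrightarrow>
     simple_graph H \<and> simple_graph G \<and> verts H \<subseteq> verts G \<and> edges H \<subseteq> edges G"

definition graph_iso :: "'a sgraph \<Rightarrow> 'b sgraph \<Rightarrow> bool" where
  "graph_iso G H \<longleftrightarrow>
     (\<exists>\<phi>. bij_betw \<phi> (verts G) (verts H) \<and> (\<lambda>e. \<phi> ` e) ` edges G = edges H)"

definition complete_graph :: "'a set \<Rightarrow> 'a sgraph" where
  "complete_graph V = (V, {e. e \<subseteq> V \<and> card e = 2})"

text \<open>The parameter counts vertices, not edges.\<close>

definition path_graph :: "nat \<Rightarrow> nat sgraph" where
  "path_graph k = ({..<k}, {{i, Suc i} | i. Suc i < k})"

text \<open>Injectivity of \<^term>\<open>edges\<close> on the blocks prevents different blocks from contributing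
  the same part of the partition.\<close>

definition design :: "'a sgraph \<Rightarrow> 'b sgraph \<Rightarrow> 'a sgraph set \<Rightarrow> bool" where
  "design K \<Gamma> \<B> \<longleftrightarrow>
     (\<forall>B\<in>\<B>. subgraph_of B K \<and> graph_iso B \<Gamma>) \<and>
     inj_on edges \<B> \<and> partition_on (edges K) (edges ` \<B>)"

definition design_of_order :: "'b sgraph \<Rightarrow> nat \<Rightarrow> 'a sgraph set \<Rightarrow> bool" where
  "design_of_order \<Gamma> n \<B> \<longleftrightarrow>
     (\<exists>V. finite V \<and> card V = n \<and> design (complete_graph V) \<Gamma> \<B>)"

definition down_link :: "('a sgraph \<Rightarrow> 'a sgraph) \<Rightarrow> 'a sgraph set \<Rightarrow> 'a sgraph set \<Rightarrow> bool" where
  "down_link f \<B> \<B>' \<longleftrightarrow> f \<in> \<B> \<rightarrow> \<B>' \<and> (\<forall>B\<in>\<B>. subgraph_of (f B) B)"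

definition down_linkable_P3 :: "'a sgraph set \<Rightarrow> nat \<Rightarrow> bool" where
  "down_linkable_P3 \<B> n \<longleftrightarrow>
     (\<exists>\<B>' f. design_of_order (path_graph 3) n \<B>' \<and> down_link f \<B> \<B>')"

text \<open>All designs have their vertices in one common infinite type, passed as the first argument,
  so that vertex sets of every finite order are available and those of a design and of its
  down-linked design may overlap in any way.\<close>

definition link_spec1 :: "'a::infinite itself \<Rightarrow> 'b sgraph \<Rightarrow> nat \<Rightarrow> int set" ("\<L>\<^sub>1") where
  "\<L>\<^sub>1 _ \<Gamma> v =
     {int n | n. \<exists>\<B> :: 'a sgraph set. design_of_order \<Gamma> v \<B> \<and> down_linkable_P3 \<B> n}"

definition link_spec2 :: "'a::infinite itself \<Rightarrow> 'b sgraph \<Rightarrow> nat \<Rightarrow> int set" ("\<L>\<^sub>2") where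
  "\<L>\<^sub>2 _ \<Gamma> v =
     {int n | n. \<forall>\<B> :: 'a sgraph set. design_of_order \<Gamma> v \<B> \<longrightarrow> down_linkable_P3 \<B> n}"

end

theory Submission
  imports Defs
begin

text \<open>Put \<open>m = max 0 (v + 1 - n)\<close> and fix a set \<open>X\<close> of \<open>m\<close> vertices of the \<open>P\<^sub>k\<close>-design. Since
  \<open>k \<ge> 3 m + 3\<close>, every block contains \<open>m + 1\<close> vertex-disjoint copies of \<open>P\<^sub>3\<close>, one of which avoids
  \<open>X\<close>. These copies live on \<open>v - m < n\<close> vertices, so a complete graph of order \<open>n\<close> containing
  them has a vertex \<open>y\<close> outside all of them. What they leave of this complete graph has an even
  number of edges, and \<open>y\<close> is adjacent to everything in it. Such a graph splits into copies of
  \<open>P\<^sub>3\<close>: assign each edge to one of its ends, using the edges at \<open>y\<close> to correct the parity of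
  every other vertex, and pair up the edges assigned to the same vertex.\<close>

section \<open>Copies of P_3 as pairs of edges\<close>

text \<open>A copy of P_3 is recorded by its edge set alone: it has no isolated vertices, so its
  vertex set is the union of its edges. Decompositions become partitions of edge sets.\<close>

definition cherry :: "'a set set \<Rightarrow> bool" where
  "cherry P \<longleftrightarrow> (\<exists>a b c. a \<noteq> b \<and> b \<noteq> c \<and> a \<noteq> c \<and> P = {{a, b}, {b, c}})"

lemma cherry_card: "cherry P \<Longrightarrow> card P = 2"
  by (auto simp: cherry_def doubleton_eq_iff)

lemma cherry_nonempty: "cherry P \<Longrightarrow> P \<noteq> {}"
  by (auto simp: cherry_def)

lemma cherry_two_edges:
  assumes "card e = 2" "card f = 2" "e \<noteq> f" "x \<in> e" "x \<in> f"
  shows "cherry {e, f}"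
proof -
  obtain a where a: "e = {a, x}" "a \<noteq> x"
    using assms(1,4) by (auto simp: card_2_iff)
  obtain b where b: "f = {x, b}" "b \<noteq> x"
    using assms(2,5) by (auto simp: card_2_iff)
  have "a \<noteq> b" using assms(3) unfolding a(1) b(1) by (metis insert_commute)
  then have "a \<noteq> x \<and> x \<noteq> b \<and> a \<noteq> b \<and> {e, f} = {{a, x}, {x, b}}"
    using a b by blast
  then show ?thesis
    unfolding cherry_def by (intro exI)
qed

lemma cherry_simple_graph: "cherry P \<Longrightarrow> simple_graph (\<Union>P, P)"
  by (auto simp: cherry_def simple_graph_def)

lemma path_graph_3: "path_graph 3 = ({0, 1, 2}, {{0, 1}, {1, 2}})"
proof -
  have "{{i, Suc i} | i. Suc i < 3} = (\<lambda>i. {i, Suc i}) ` {0, 1}"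
    by (auto simp: less_Suc_eq numeral_3_eq_3)
  moreover have "{..<3} = {0, 1, 2 :: nat}"
    by auto
  ultimately show ?thesis
    by (simp add: path_graph_def numeral_2_eq_2)
qed

lemma cherry_graph_iso:
  assumes "cherry P"
  shows "graph_iso (\<Union>P, P) (path_graph 3)"
proof -
  obtain a b c where d: "a \<noteq> b" "b \<noteq> c" "a \<noteq> c" and P: "P = {{a, b}, {b, c}}"
    using assms by (auto simp: cherry_def)
  \<comment> \<open>The default value 2 serves \<open>c\<close>; the centre \<open>b\<close> goes to
    the middle vertex 1.\<close>
  let ?f = "(\<lambda>_. 2 :: nat)(a := 0, b := 1)"
  have "bij_betw ?f (\<Union>P) {0, 1, 2}"
    using d P by (auto simp: bij_betw_def inj_on_def)
  moreover have "(\<lambda>e. ?f ` e) ` P = {{0, 1}, {1, 2}}"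
    using d P by auto
  ultimately show ?thesis
    unfolding graph_iso_def path_graph_3 fst_conv snd_conv by (intro exI[of _ ?f] conjI)
qed

text \<open>Leads from edge partitions back to designs. \<open>edges\<close> recovers
  \<open>P\<close> from \<open>(\<Union>P, P)\<close>, so it is injective on these blocks.\<close>

lemma design_of_cherries:
  assumes fin: "finite V" and part: "partition_on (edges (complete_graph V)) \<P>"
    and ch: "\<And>P. P \<in> \<P> \<Longrightarrow> cherry P"
  shows "design (complete_graph V) (path_graph 3) ((\<lambda>P. (\<Union>P, P)) ` \<P>)"
proof -
  have "subgraph_of (\<Union>P, P) (complete_graph V)" if "P \<in> \<P>" for P
  proof -
    have "P \<subseteq> {e. e \<subseteq> V \<and> card e = 2}"
      using that partition_onD1[OF part] by (auto simp: complete_graph_def)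
    then have "\<Union>P \<subseteq> V" "P \<subseteq> {e. e \<subseteq> V \<and> card e = 2}" by auto
    then show ?thesis
      using fin cherry_simple_graph[OF ch[OF that]]
      by (simp add: subgraph_of_def simple_graph_def complete_graph_def)
  qed
  moreover have "graph_iso (\<Union>P, P) (path_graph 3)" if "P \<in> \<P>" for P
    using ch[OF that] by (rule cherry_graph_iso)
  moreover have "edges ` (\<lambda>P. (\<Union>P, P)) ` \<P> = \<P>"
    by (simp add: image_image)
  moreover have "inj_on edges ((\<lambda>P. (\<Union>P, P)) ` \<P>)"
    by (auto simp: inj_on_def)
  ultimately show ?thesis
    using part unfolding design_def by simp
qed

section \<open>Decomposing a graph into cherries\<close>

text \<open>Edges assigned to the same vertex share it, so any two of them form a cherry. Removing
  such a pair shrinks one fibre of \<open>c\<close> by two and keeps the others, so evenness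
  survives the induction.\<close>

lemma cherry_partition_of_assignment:
  assumes "finite E" and "\<And>e. e \<in> E \<Longrightarrow> card e = 2 \<and> c e \<in> e"
    and "\<And>w. even (card {e \<in> E. c e = w})"
  shows "\<exists>\<P>. partition_on E \<P> \<and> (\<forall>P\<in>\<P>. cherry P)"
  using assms
proof (induction "card E" arbitrary: E rule: less_induct)
  case less
  show ?case
  proof (cases "E = {}")
    case True
    then show ?thesis by (intro exI[of _ "{}"]) (auto simp: partition_on_def)
  next
    case False
    then obtain e where e: "e \<in> E" by auto
    let ?S = "{g \<in> E. c g = c e}"
    \<comment> \<open>An even fibre containing \<open>e\<close> must contain a partner
      \<open>f\<close> for it.\<close>
    have "?S \<noteq> {e}"
    proof
      assume "?S = {e}"
      then have "card ?S = 1" by simp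
      then show False using less.prems(3)[of "c e"] by simp
    qed
    then obtain f where f: "f \<in> E" "c f = c e" "f \<noteq> e"
      using e by blast
    let ?E = "E - {e, f}"
    have cherry: "cherry {e, f}"
      using less.prems(2)[OF e] less.prems(2)[OF f(1)] f
      by (intro cherry_two_edges[of e f "c e"]) auto
    have "even (card {g \<in> ?E. c g = w})" for w
    proof (cases "w = c e")
      case True
      then have "{g \<in> ?E. c g = w} = ?S - {e, f}" by auto
      moreover have "card (?S - {e, f}) = card ?S - 2"
        using e f less.prems(1) by (subst card_Diff_subset) auto
      ultimately show ?thesis using less.prems(3)[of "c e"] by simp
    next
      case False
      then have "{g \<in> ?E. c g = w} = {g \<in> E. c g = w}" using f by auto
      then show ?thesis using less.prems(3)[of w] by simp
    qed
    moreover have "card ?E < card E"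
      using less.prems(1) e by (intro psubset_card_mono) auto
    ultimately have "\<exists>\<P>. partition_on ?E \<P> \<and> (\<forall>P\<in>\<P>. cherry P)"
      using less.prems(1,2) by (intro less.hyps) auto
    then obtain \<P> where \<P>: "partition_on ?E \<P>" "\<forall>P\<in>\<P>. cherry P"
      by blast
    have "partition_on E (insert {e, f} \<P>)"
      using \<P>(1) e f(1) by (subst partition_on_insert) (auto simp: disjnt_def dest: partition_onD1)
    then show ?thesis using \<P>(2) cherry by blast
  qed
qed

text \<open>Moving the edge \<open>{y, w}\<close> from one end to the other switches the parity at
  \<open>w\<close> and affects no third vertex. The parity at \<open>y\<close> is then forced by the
  even total.\<close>

lemma cherry_partition_dominating_vertex:
  assumes fin: "finite W" and E: "E \<subseteq> edges (complete_graph W)" and ev: "even (card E)"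
    and dom: "\<And>w. w \<in> W \<Longrightarrow> w \<noteq> y \<Longrightarrow> {y, w} \<in> E"
  shows "\<exists>\<P>. partition_on E \<P> \<and> (\<forall>P\<in>\<P>. cherry P)"
proof -
  have E': "e \<subseteq> W \<and> card e = 2" if "e \<in> E" for e
    using E that by (auto simp: complete_graph_def)
  have finE: "finite E"
    using E' fin by (intro finite_subset[of E "Pow W"]) auto
  \<comment> \<open>For an edge at \<open>y\<close> this is the other end; for any other edge it is
    an arbitrary end.\<close>
  define p where "p e = (SOME x. x \<in> e - {y})" for e
  define D where "D w = {e \<in> E. y \<notin> e \<and> p e = w}" for w
  \<comment> \<open>The edge \<open>{y, w}\<close> goes to \<open>w\<close> exactly when the edges
    away from \<open>y\<close> give \<open>w\<close> an odd number.\<close>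
  define c where "c e = (if y \<in> e \<and> even (card (D (p e))) then y else p e)" for e
  have p: "p e \<in> e - {y}" if "e \<in> E" for e
  proof -
    have "\<exists>x. x \<in> e - {y}" using E'[OF that] by (auto simp: card_2_iff)
    then show ?thesis unfolding p_def by (rule someI_ex)
  qed
  have c: "card e = 2 \<and> c e \<in> e" if "e \<in> E" for e
    using p[OF that] E'[OF that] by (auto simp: c_def)
  let ?F = "\<lambda>w. {e \<in> E. c e = w}"
  have even_F: "even (card (?F w))" if w: "w \<noteq> y" for w
  proof (cases "w \<in> W")
    case False
    then have "?F w = {}" using c E' by blast
    then show ?thesis by (metis card.empty even_zero)
  next
    case True
    have yw: "{y, w} \<in> E" using dom True w by simp
    have p_yw: "p {y, w} = w" using p[OF yw] by auto
    have edge: "e = {y, w}" if "e \<in> E" "y \<in> e" "p e = w" for e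
      using E'[OF that(1)] p[OF that(1)] that(2,3) by (auto simp: card_2_iff)
    have finD: "finite (D w)" using finE by (auto simp: D_def)
    show ?thesis
    proof (cases "even (card (D w))")
      case even: True
      have "?F w = D w"
        using w even edge by (auto simp: c_def D_def split: if_splits)
      then show ?thesis using even by simp
    next
      case odd: False
      have "?F w = insert {y, w} (D w)"
      proof (intro set_eqI iffI)
        fix e assume e: "e \<in> ?F w"
        show "e \<in> insert {y, w} (D w)"
        proof (cases "y \<in> e")
          case True
          then have "p e = w" using e w by (auto simp: c_def split: if_splits)
          then show ?thesis using edge True e by blast
        next
          case False
          then show ?thesis using e by (auto simp: c_def D_def)
        qed
      next
        fix e assume "e \<in> insert {y, w} (D w)"
        then show "e \<in> ?F w" using odd yw p_yw by (auto simp: c_def D_def)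
      qed
      moreover have "{y, w} \<notin> D w" by (simp add: D_def)
      ultimately show ?thesis using odd finD by simp
    qed
  qed
  \<comment> \<open>The fibres of \<open>c\<close> partition \<open>E\<close>; all the other fibres
    are even, and so is \<open>card E\<close>.\<close>
  have "even (card (?F y))"
  proof -
    have "E - ?F y = (\<Union>w \<in> W - {y}. ?F w)"
      using c E' by blast
    moreover have "card (\<Union>w \<in> W - {y}. ?F w) = (\<Sum>w \<in> W - {y}. card (?F w))"
      using fin finE by (intro card_UN_disjoint) auto
    moreover have "even (\<Sum>w \<in> W - {y}. card (?F w))"
      using even_F by (intro dvd_sum) auto
    ultimately have "even (card (E - ?F y))" by simp
    moreover have "card E = card (?F y) + card (E - ?F y)"
      using finE by (metis (no_types, lifting) card_Int_Diff inf.absorb_iff2 mem_Collect_eq subsetI)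
    ultimately show ?thesis using ev by simp
  qed
  then have "even (card (?F w))" for w using even_F by (cases "w = y") auto
  then show ?thesis
    using finE c by (intro cherry_partition_of_assignment[of E c]) auto
qed

section \<open>A cherry in each block that avoids a small set\<close>

text \<open>Pigeonhole: the first \<open>3 * (card X + 1)\<close> vertices of the path form
  consecutive disjoint triples. These outnumber the elements of \<open>X\<close>, so one of them
  misses \<open>X\<close>.\<close>

lemma path_cherry_avoiding:
  assumes B: "simple_graph B" and iso: "graph_iso B (path_graph k)"
    and fin: "finite X" and k: "3 * card X + 3 \<le> k"
  shows "\<exists>P. cherry P \<and> P \<subseteq> edges B \<and> \<Union>P \<inter> X = {}"
proof -
  obtain \<phi> where bij: "bij_betw \<phi> (verts B) {..<k}"
    and ed: "(\<lambda>e. \<phi> ` e) ` edges B = {{i, Suc i} | i. Suc i < k}"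
    using iso by (auto simp: graph_iso_def path_graph_def)
  \<comment> \<open>\<open>\<psi> i\<close> is the vertex at position \<open>i\<close> along the
    path, counted from 0.\<close>
  define \<psi> where "\<psi> = inv_into (verts B) \<phi>"
  have inj: "inj_on \<psi> {..<k}"
    using bij unfolding \<psi>_def by (metis bij_betw_def inj_on_inv_into order_refl)
  have edge: "{\<psi> i, \<psi> (Suc i)} \<in> edges B" if "Suc i < k" for i
  proof -
    have "{i, Suc i} \<in> (\<lambda>e. \<phi> ` e) ` edges B" using ed that by blast
    then obtain e where e: "e \<in> edges B" "\<phi> ` e = {i, Suc i}" by auto
    have "\<psi> ` \<phi> ` e = e"
      using B e(1) bij unfolding \<psi>_def
      by (intro inv_into_image_cancel) (auto simp: simple_graph_def bij_betw_def)
    then show ?thesis using e by auto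
  qed
  let ?T = "\<lambda>i. {\<psi> (3 * i), \<psi> (3 * i + 1), \<psi> (3 * i + 2)}"
  have "\<exists>i \<le> card X. ?T i \<inter> X = {}"
  proof (rule ccontr)
    \<comment> \<open>If all triples met \<open>X\<close>, let \<open>j i\<close> be a position in
      triple \<open>i\<close> whose vertex lies in \<open>X\<close>. As \<open>j i div 3\<close>
      recovers \<open>i\<close>, the map \<open>\<psi> \<circ> j\<close> injects
      \<open>card X + 1\<close> indices into \<open>X\<close>.\<close>
    assume "\<not> ?thesis"
    then have "\<forall>i\<in>{..card X}. \<exists>j. j div 3 = i \<and> \<psi> j \<in> X"
      by force
    then obtain j where j: "\<And>i. i \<le> card X \<Longrightarrow> j i div 3 = i \<and> \<psi> (j i) \<in> X"
      by (metis atMost_iff)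
    have "j i < k" if "i \<le> card X" for i
      using j[OF that] that k by linarith
    then have "inj_on (\<psi> \<circ> j) {..card X}"
      using j inj by (intro inj_onI) (metis atMost_iff comp_apply inj_onD lessThan_iff)
    moreover have "(\<psi> \<circ> j) ` {..card X} \<subseteq> X" using j by auto
    ultimately have "card {..card X} \<le> card X" using fin by (rule card_inj_on_le)
    then show False by simp
  qed
  then obtain i where i: "i \<le> card X" "?T i \<inter> X = {}" by blast
  have lt: "3 * i + 2 < k" using i(1) k by linarith
  let ?P = "{{\<psi> (3 * i), \<psi> (3 * i + 1)}, {\<psi> (3 * i + 1), \<psi> (3 * i + 2)}}"
  have "\<psi> (3 * i) \<noteq> \<psi> (3 * i + 1)" "\<psi> (3 * i + 1) \<noteq> \<psi> (3 * i + 2)" "\<psi> (3 * i) \<noteq> \<psi> (3 * i + 2)"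
    using lt by (auto simp: inj_on_eq_iff[OF inj])
  then have "cherry ?P" by (auto simp: cherry_def)
  moreover have "?P \<subseteq> edges B" using edge[of "3 * i"] edge[of "3 * i + 1"] lt by simp
  moreover have "\<Union>?P \<inter> X = {}" using i(2) by auto
  ultimately show ?thesis by blast
qed

section \<open>Extending the chosen cherries to a P_3-design\<close>

text \<open>This is where the residues 0 and 1 modulo 4 enter: 4 divides \<open>card W\<close> or
  \<open>card W - 1\<close>, and half the product of the two is even.\<close>

lemma even_card_edges_complete_graph:
  assumes "finite W" "card W mod 4 \<in> {0, 1}"
  shows "even (card (edges (complete_graph W)))"
proof -
  have "card (edges (complete_graph W)) = card W * (card W - 1) div 2"
    using n_subsets[OF assms(1), of 2] by (simp add: complete_graph_def choose_two)
  moreover have "4 dvd card W * (card W - 1)"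
  proof (cases "card W mod 4 = 0")
    case False
    then have "card W mod 4 = 1" using assms(2) by simp
    then have "4 dvd card W - 1" by presburger
    then show ?thesis by simp
  qed auto
  ultimately show ?thesis by auto
qed

lemma design_down_linkable_P3:
  fixes \<B> :: "'a::infinite sgraph set"
  assumes des: "design_of_order (path_graph k) v \<B>" and k: "3 * (v + 1 - n) + 3 \<le> k"
    and n: "n > 0" "n mod 4 \<in> {0, 1}"
  shows "down_linkable_P3 \<B> n"
proof -
  obtain V :: "'a set" where finV: "finite V" and cardV: "card V = v"
    and D: "design (complete_graph V) (path_graph k) \<B>"
    using des by (auto simp: design_of_order_def)
  \<comment> \<open>Truncated subtraction yields \<open>max 0 (v + 1 - n)\<close>; since
    \<open>n > 0\<close>, this is at most \<open>v\<close>, so \<open>X\<close> fits into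
    \<open>V\<close>.\<close>
  have "v + 1 - n \<le> card V" using cardV n(1) by linarith
  then obtain X where X: "X \<subseteq> V" "card X = v + 1 - n" "finite X"
    by (rule obtain_subset_with_card_n)
  \<comment> \<open>\<open>V - X\<close> has \<open>v\<close> vertices if \<open>n > v\<close> and
    \<open>n - 1\<close> otherwise. Strictness leaves room for \<open>y\<close>.\<close>
  have cardVX: "card (V - X) < n"
    using X cardV n(1) by (simp add: card_Diff_subset)
  \<comment> \<open>\<open>Y\<close> only has to avoid \<open>V - X\<close> and may reuse vertices
    of \<open>X\<close>.\<close>
  obtain Y where Y: "Y \<subseteq> - (V - X)" "finite Y" "card Y = n - card (V - X)"
    using infinite_arbitrarily_large[of "- (V - X)" "n - card (V - X)"] finV infinite_UNIV
    by (metis Compl_eq_Diff_UNIV Diff_infinite_finite finite_Diff)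
  define W where "W = (V - X) \<union> Y"
  have finW: "finite W" using finV Y by (simp add: W_def)
  have cardW: "card W = n"
    using Y finV cardVX unfolding W_def by (subst card_Un_disjoint) auto
  obtain y where y: "y \<in> Y" using Y(3) cardVX by fastforce
  have "\<forall>B\<in>\<B>. \<exists>P. cherry P \<and> P \<subseteq> edges B \<and> \<Union>P \<inter> X = {}"
    using D X k by (auto simp: design_def subgraph_of_def intro!: path_cherry_avoiding)
  then obtain g where g: "\<And>B. B \<in> \<B> \<Longrightarrow> cherry (g B) \<and> g B \<subseteq> edges B \<and> \<Union>(g B) \<inter> X = {}"
    by metis
  have sub: "subgraph_of B (complete_graph V)" if "B \<in> \<B>" for B
    using D that by (auto simp: design_def)
  have gVX: "e \<subseteq> V - X \<and> card e = 2" if "B \<in> \<B>" "e \<in> g B" for B e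
    using g[OF that(1)] sub[OF that(1)] that(2)
    by (auto simp: subgraph_of_def complete_graph_def)
  \<comment> \<open>Distinct blocks have distinct edge sets by injectivity of \<open>edges\<close>,
    and distinct parts of a partition are disjoint.\<close>
  have disj: "g B \<inter> g C = {}" if "B \<in> \<B>" "C \<in> \<B>" "B \<noteq> C" for B C
  proof -
    have "edges B \<noteq> edges C" using D that by (auto simp: design_def inj_on_eq_iff)
    then have "edges B \<inter> edges C = {}"
      using D that unfolding design_def partition_on_def disjoint_def by blast
    then show ?thesis using g[OF that(1)] g[OF that(2)] by blast
  qed
  let ?K = "edges (complete_graph W)"
  define R where "R = \<Union>(g ` \<B>)"
  have RK: "R \<subseteq> ?K"
    using gVX by (auto simp: R_def W_def complete_graph_def)
  have finK: "finite ?K"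
    using finW by (auto simp: complete_graph_def)
  have partR: "partition_on R (g ` \<B>)"
    unfolding R_def
  proof (intro partition_onI)
    show "disjnt p q" if "p \<in> g ` \<B>" "q \<in> g ` \<B>" "p \<noteq> q" for p q
      using that disj unfolding disjnt_def by blast
    show "{} \<notin> g ` \<B>" using g cherry_nonempty by blast
  qed simp
  have "even (card R)"
  proof -
    have "finite P" if "P \<in> g ` \<B>" for P
      using that g cherry_card by (metis card.infinite imageE zero_neq_numeral)
    then have "card R = sum card (g ` \<B>)"
      by (rule product_partition[OF partR])
    moreover have "even (sum card (g ` \<B>))"
      using g by (intro dvd_sum) (auto simp: cherry_card)
    ultimately show ?thesis by simp
  qed
  then have "even (card (?K - R))"
    using even_card_edges_complete_graph[OF finW] n(2) cardW RK finK
    by (simp add: card_Diff_subset finite_subset)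
  \<comment> \<open>All edges of \<open>R\<close> lie inside \<open>V - X\<close>, and
    \<open>y\<close> does not, so no edge at \<open>y\<close> has been removed.\<close>
  moreover have "{y, w} \<in> ?K - R" if "w \<in> W" "w \<noteq> y" for w
  proof -
    have "{y, w} \<in> ?K" using that y by (auto simp: W_def complete_graph_def)
    moreover have "{y, w} \<notin> R"
    proof
      assume "{y, w} \<in> R"
      then have "{y, w} \<subseteq> V - X" unfolding R_def using gVX by blast
      then show False using y Y(1) by blast
    qed
    ultimately show ?thesis by simp
  qed
  ultimately have "\<exists>\<Q>. partition_on (?K - R) \<Q> \<and> (\<forall>P\<in>\<Q>. cherry P)"
    by (intro cherry_partition_dominating_vertex[OF finW, of "?K - R" y]) auto
  then obtain \<Q> where Q: "partition_on (?K - R) \<Q>" "\<forall>P\<in>\<Q>. cherry P"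
    by blast
  have "partition_on ?K (g ` \<B> \<union> \<Q>)"
  proof -
    have "\<Union>(g ` \<B>) = R" and "\<Union>\<Q> = ?K - R"
      using partition_onD1[OF partR] partition_onD1[OF Q(1)] by simp_all
    then have U: "\<Union>(g ` \<B>) \<inter> \<Union>\<Q> = {}" "\<Union>(g ` \<B> \<union> \<Q>) = ?K"
      using RK unfolding Union_Un_distrib by (simp_all add: Un_absorb1)
    then have "disjoint (g ` \<B> \<union> \<Q>)"
      by (intro disjoint_union partition_onD2[OF partR] partition_onD2[OF Q(1)])
    then show ?thesis
      using U(2) partition_onD3[OF partR] partition_onD3[OF Q(1)] unfolding partition_on_def by blast
  qed
  then have "design (complete_graph W) (path_graph 3) ((\<lambda>P. (\<Union>P, P)) ` (g ` \<B> \<union> \<Q>))"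
    using g Q(2) by (intro design_of_cherries[OF finW]) auto
  moreover have "down_link (\<lambda>B. (\<Union>(g B), g B)) \<B> ((\<lambda>P. (\<Union>P, P)) ` (g ` \<B> \<union> \<Q>))"
  proof -
    have "subgraph_of (\<Union>(g B), g B) B" if "B \<in> \<B>" for B
      using g[OF that] sub[OF that] cherry_simple_graph[of "g B"]
      by (auto simp: subgraph_of_def simple_graph_def)
    then show ?thesis by (auto simp: down_link_def)
  qed
  ultimately show ?thesis
    unfolding down_linkable_P3_def design_of_order_def using finW cardW by blast
qed

section \<open>From the bound on n to the two spectra\<close>

text \<open>For \<open>v > 1\<close> there is an edge to cover, hence a block, whose
  \<open>k\<close> vertices lie in \<open>V\<close>. For \<open>v \<le> 1\<close> the empty set of
  blocks is a design whatever \<open>k\<close> is.\<close>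

lemma design_path_order_ge:
  fixes \<B> :: "'a sgraph set"
  assumes "design_of_order (path_graph k) v \<B>" "v > 1"
  shows "k \<le> v"
proof -
  obtain V :: "'a set" where V: "finite V" "card V = v"
    and D: "design (complete_graph V) (path_graph k) \<B>"
    using assms(1) by (auto simp: design_of_order_def)
  obtain e where "e \<subseteq> V" "card e = 2"
    using obtain_subset_with_card_n[of 2 V] V assms(2) by auto
  then have "\<B> \<noteq> {}"
    using D by (auto simp: design_def partition_on_def complete_graph_def)
  then obtain B where "subgraph_of B (complete_graph V)" "graph_iso B (path_graph k)"
    using D by (auto simp: design_def)
  then obtain \<phi> where "verts B \<subseteq> V" "bij_betw \<phi> (verts B) {..<k}"
    by (auto simp: subgraph_of_def complete_graph_def graph_iso_def path_graph_def)
  then have "verts B \<subseteq> V" "card (verts B) = k"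
    using bij_betw_same_card by fastforce+
  then show ?thesis using card_mono[OF V(1)] V(2) by auto
qed

theorem theorem8p2:
  fixes k v :: nat
  assumes "k > 4" and "v > 1"
    and "\<exists>\<B> :: 'a::infinite sgraph set. design_of_order (path_graph k) v \<B>"
  shows "{n :: int. n \<ge> int v - \<lfloor>(real k - 6) / 3\<rfloor> \<and> n mod 4 \<in> {0, 1}}
           \<subseteq> \<L>\<^sub>2 TYPE('a) (path_graph k) v
       \<and> \<L>\<^sub>2 TYPE('a) (path_graph k) v \<subseteq> \<L>\<^sub>1 TYPE('a) (path_graph k) v"
proof
  \<comment> \<open>This makes \<open>n\<close> positive below: 3n \<ge> 3v - k + 6 \<ge> 2v +
    6.\<close>
  have kv: "k \<le> v" using assms design_path_order_ge by blast
  show "{n :: int. n \<ge> int v - \<lfloor>(real k - 6) / 3\<rfloor> \<and> n mod 4 \<in> {0, 1}}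
           \<subseteq> \<L>\<^sub>2 TYPE('a) (path_graph k) v"
  proof
    fix n :: int
    assume "n \<in> {n. n \<ge> int v - \<lfloor>(real k - 6) / 3\<rfloor> \<and> n mod 4 \<in> {0, 1}}"
    then have n: "n \<ge> int v - \<lfloor>(real k - 6) / 3\<rfloor>" "n mod 4 \<in> {0, 1}" by auto
    have "real_of_int \<lfloor>(real k - 6) / 3\<rfloor> \<le> (real k - 6) / 3" by (rule of_int_floor_le)
    then have "real_of_int (3 * \<lfloor>(real k - 6) / 3\<rfloor>) \<le> real_of_int (int k - 6)" by simp
    then have "3 * \<lfloor>(real k - 6) / 3\<rfloor> \<le> int k - 6" by (simp only: of_int_le_iff)
    moreover have "3 * (int v - n) \<le> 3 * \<lfloor>(real k - 6) / 3\<rfloor>" using n(1) by simp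
    ultimately have le: "3 * (int v - n) \<le> int k - 6" by (rule order_trans[rotated])
    moreover have "int k \<le> int v" using kv by simp
    ultimately have "n > 0" by presburger
    then obtain m where m: "n = int m" "m > 0" using zero_less_imp_eq_int by blast
    have "int (3 * v + 6) \<le> int (k + 3 * m)" using le m(1) by simp
    \<comment> \<open>Source of the constant 6: with d = v - m, avoiding d + 1 vertices takes 3(d +
      1) + 3 = 3d + 6 path vertices. If the subtraction gives 0, only 3 \<le> k remains, which
      follows from \<open>k > 4\<close>.\<close>
    then have "3 * (v + 1 - m) + 3 \<le> k" using assms(1) by linarith
    moreover have "m mod 4 \<in> {0, 1}" using n(2) m(1) by auto presburger+
    ultimately have "\<forall>\<B> :: 'a sgraph set. design_of_order (path_graph k) v \<B> \<longrightarrow>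
        down_linkable_P3 \<B> m"
      using m(2) by (intro allI impI) (rule design_down_linkable_P3)
    then show "n \<in> \<L>\<^sub>2 TYPE('a) (path_graph k) v"
      using m(1) by (auto simp: link_spec2_def)
  qed
  show "\<L>\<^sub>2 TYPE('a) (path_graph k) v \<subseteq> \<L>\<^sub>1 TYPE('a) (path_graph k) v"
    \<comment> \<open>Passing from every design to some design uses that one exists.\<close>
    using assms(3) unfolding link_spec1_def link_spec2_def by blast
qed

end
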